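(* Let $(I_n)_{n\ge 0}$ be the sequence defined by $I_0 = 1$, $I_1 = 2$, and $I_n = 2\bigl(I_{n-1} + (n-1) I_{n-2}\bigr)$ for all integers $n \ge 2$. Then, as $n \to \infty$, $$I_n = \frac{e^{\sqrt{2n}}}{\sqrt{2e}} \left(\frac{2n}{e}\right)^{n/2} \left(1 + \frac{\sqrt{2}}{3\sqrt{n}} + O(n^{-1})\right).$$
   Context: Here $e$ is the base of the natural logarithm, and $O(n^{-1})$ denotes a quantity bounded in absolute value by $C/n$ for some constant $C$ and all sufficiently large integers $n$. *)

theory Defs
  imports "HOL-Library.Landau_Symbols" "HOL-Analysis.Analysis"
begin

end

(* The recurrence is that of the raw moments of the normal distribution with mean 2 and variance 2
   (integrate the derivative of x^(k+1) times the density), so I n = E[X^n]. Substituting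
   X = sqrt (2n) + sqrt 2 * u, the factor (2n/e)^(n/2) e^(sqrt (2n)) / sqrt (2e) splits off and
   what remains is E[(1+v)^n exp (-n v + n v^2/2)], where v = u / sqrt n and u is normal with mean
   1/sqrt 2 and variance 1/2. The expression under the expectation is
   exp (n (v^3/3 + O(v^4))) = 1 + u^3/(3 sqrt n) + O(1/n), with an error dominated by 1/n times an
   integrable function, and E[u^3] = sqrt 2. *)
theory Submission
  imports Defs "HOL-Probability.Probability" "HOL-Real_Asymp.Real_Asymp"
begin

section \<open>Raw moments of the normal distribution and their recurrence\<close>

lemma integrable_normal_raw_moment:
  fixes \<mu> \<sigma> :: real
  assumes "\<sigma> > 0"
  shows "integrable lborel (\<lambda>x. x ^ k * normal_density \<mu> \<sigma> x)"
proof -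
  have "x ^ k * normal_density \<mu> \<sigma> x
      = (\<Sum>j\<le>k. (of_nat (k choose j) * \<mu> ^ (k - j)) * (normal_density \<mu> \<sigma> x * (x - \<mu>) ^ j))" for x
    using binomial_ring[of "x - \<mu>" \<mu> k] by (simp add: sum_distrib_left sum_distrib_right mult_ac)
  then show ?thesis
    using integrable_normal_moment[OF assms] by simp
qed

lemma tendsto_power_times_normal_density:
  fixes \<mu> \<sigma> :: real
  assumes "\<sigma> > 0"
  shows "((\<lambda>x. x ^ k * normal_density \<mu> \<sigma> x) \<longlongrightarrow> 0) at_top"
    and "((\<lambda>x. x ^ k * normal_density \<mu> \<sigma> x) \<longlongrightarrow> 0) at_bot"
  using assms unfolding normal_density_def by real_asymp+

lemma normal_raw_moment_rec:
  fixes \<mu> \<sigma> :: real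
  assumes "\<sigma> > 0"
  defines "M \<equiv> \<lambda>k. \<integral>x. x ^ k * normal_density \<mu> \<sigma> x \<partial>lborel"
  shows "M (Suc (Suc k)) = \<mu> * M (Suc k) + \<sigma>\<^sup>2 * real (Suc k) * M k"
proof -
  let ?d = "normal_density \<mu> \<sigma>"
  \<comment> \<open>This is the derivative of \<open>x ^ Suc k * ?d x\<close>, already split into
    multiples of moment integrands. As the antiderivative vanishes at both ends, its integral is 0,
    which is the recurrence.\<close>
  define f where "f = (\<lambda>x. real (Suc k) * (x ^ k * ?d x)
      - (1 / \<sigma>\<^sup>2) * (x ^ Suc (Suc k) * ?d x) + (\<mu> / \<sigma>\<^sup>2) * (x ^ Suc k * ?d x))"
  note int = integrable_normal_raw_moment[OF assms(1)]
  have f_int: "integrable lborel f"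
    unfolding f_def by (intro Bochner_Integration.integrable_add Bochner_Integration.integrable_diff
      integrable_mult_right int)
  have d: "(?d has_real_derivative (- (x - \<mu>) / \<sigma>\<^sup>2 * ?d x)) (at x)" for x
  proof -
    have "((\<lambda>x. - (x - \<mu>)\<^sup>2 / (2 * \<sigma>\<^sup>2)) has_real_derivative - (x - \<mu>) / \<sigma>\<^sup>2) (at x)"
      using assms(1) by (auto intro!: derivative_eq_intros simp: field_simps)
    from DERIV_cmult[OF DERIV_fun_exp[OF this], of "1 / sqrt (2 * pi * \<sigma>\<^sup>2)"] show ?thesis
      unfolding normal_density_def by (simp add: mult_ac)
  qed
  have "((\<lambda>x. x ^ Suc k * ?d x) has_real_derivative f x) (at x)" for x
    by (rule derivative_eq_intros d refl)+ (use assms(1) in \<open>simp add: f_def field_simps\<close>)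
  moreover have "isCont f x" for x
    unfolding f_def normal_density_def using assms(1) by (intro continuous_intros) auto
  ultimately have "(LBINT x=-\<infinity>..\<infinity>. f x) = 0 - 0"
    using tendsto_power_times_normal_density[OF assms(1), of "Suc k" \<mu>] f_int
    by (intro interval_integral_FTC_integrable[where F = "\<lambda>x. x ^ Suc k * ?d x"])
       (auto simp: has_real_derivative_iff_has_vector_derivative ereal_tendsto_simps
         set_integrable_def)
  then have "integral\<^sup>L lborel f = 0"
    by (simp add: interval_lebesgue_integral_def set_lebesgue_integral_def)
  moreover have "integral\<^sup>L lborel f
      = real (Suc k) * M k - (1 / \<sigma>\<^sup>2) * M (Suc (Suc k)) + (\<mu> / \<sigma>\<^sup>2) * M (Suc k)"
    unfolding f_def M_def
    by (simp only: Bochner_Integration.integral_add Bochner_Integration.integral_diff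
      integral_mult_right_zero integrable_mult_right int Bochner_Integration.integrable_diff)
  ultimately show ?thesis
    using assms(1) by (simp add: field_simps)
qed

section \<open>Elementary estimates for exp, ln and powers\<close>

text \<open>Only an upper bound on \<open>x\<close> enters, so \<open>x\<close> may be very
  negative: there the remainder is at most \<open>x\<^sup>2 / 2\<close>, while for
  \<open>x \<ge> 0\<close> the Lagrange form applies.\<close>

lemma exp_minus_one_minus_id_bound:
  fixes x b :: real
  assumes "x \<le> b" "0 \<le> b"
  shows "\<bar>exp x - 1 - x\<bar> \<le> x\<^sup>2 / 2 * exp b"
proof -
  obtain t where t: "\<bar>t\<bar> \<le> \<bar>x\<bar>" "exp x = (\<Sum>m<2. x ^ m / fact m) + exp t / fact 2 * x\<^sup>2"
    using Maclaurin_exp_le[of x 2] by auto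
  consider "x \<ge> 0" | "x < 0" by linarith
  then show ?thesis
  proof cases
    case 1
    then have "exp t \<le> exp b" using t(1) assms by simp
    then have "exp t / 2 * x\<^sup>2 \<le> exp b / 2 * x\<^sup>2" by (intro mult_right_mono) auto
    moreover have "exp x - 1 - x = exp t / 2 * x\<^sup>2" using t(2) by (simp add: eval_nat_numeral)
    moreover have "exp x - 1 - x \<ge> 0" using exp_ge_add_one_self[of x] by linarith
    ultimately show ?thesis by (simp add: mult.commute)
  next
    case 2
    \<comment> \<open>\<open>q\<close> is nondecreasing because its derivative is nonnegative, and
      \<open>q 0 = 0\<close>; hence \<open>q x \<le> 0\<close> for negative
      \<open>x\<close>.\<close>
    define q where "q = (\<lambda>x::real. exp x - 1 - x - x\<^sup>2 / 2)"
    have "(q has_real_derivative exp y - 1 - y) (at y)" for y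
      unfolding q_def by (auto intro!: derivative_eq_intros)
    moreover have "exp y - 1 - y \<ge> 0" for y :: real
      using exp_ge_add_one_self[of y] by linarith
    ultimately have "\<exists>D. (q has_real_derivative D) (at y) \<and> D \<ge> 0" for y by blast
    with 2 have "q x \<le> q 0"
      by (intro DERIV_nonneg_imp_nondecreasing[of x 0 q]) auto
    then have "exp x - 1 - x \<le> x\<^sup>2 / 2 * 1" by (simp add: q_def)
    also have "\<dots> \<le> x\<^sup>2 / 2 * exp b" using assms(2) by (intro mult_left_mono) auto
    finally show ?thesis using exp_ge_add_one_self[of x] by linarith
  qed
qed

text \<open>The expression inside the absolute value has derivative
  \<open>- (w ^ 3) / (1 + w)\<close>. Between 0 and \<open>v\<close> one has
  \<open>1 + w \<ge> 1 / 2\<close>, so the mean value inequality gives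
  \<open>2 * \<bar>v\<bar> ^ 3\<close> times \<open>\<bar>v\<bar>\<close>.\<close>

lemma ln_cubic_taylor_bound:
  fixes v :: real
  assumes "v \<ge> - 1 / 2"
  shows "\<bar>ln (1 + v) - v + v\<^sup>2 / 2 - v ^ 3 / 3\<bar> \<le> 2 * v ^ 4"
proof -
  define p where "p = (\<lambda>v::real. ln (1 + v) - v + v\<^sup>2 / 2 - v ^ 3 / 3)"
  have dp: "(p has_real_derivative - (w ^ 3) / (1 + w)) (at w within S)" if "w > - 1" for w S
  proof -
    have "(p has_real_derivative 1 / (1 + w) - 1 + w - w\<^sup>2) (at w within S)"
      unfolding p_def using that by (auto intro!: derivative_eq_intros)
    moreover have "1 / (1 + w) - 1 + w - w\<^sup>2 = - (w ^ 3) / (1 + w)"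
      using that by (simp add: field_simps power2_eq_square power3_eq_cube)
    ultimately show ?thesis by simp
  qed
  have seg: "w \<ge> - 1 / 2 \<and> \<bar>w\<bar> \<le> \<bar>v\<bar>" if "w \<in> closed_segment 0 v" for w
    using that assms by (auto simp: closed_segment_eq_real_ivl split: if_splits)
  have "norm (- (w ^ 3) / (1 + w)) \<le> 2 * \<bar>v\<bar> ^ 3" if "w \<in> closed_segment 0 v" for w
  proof -
    have "\<bar>w\<bar> ^ 3 \<le> \<bar>v\<bar> ^ 3" using seg[OF that] by (intro power_mono) auto
    also have "\<dots> \<le> \<bar>v\<bar> ^ 3 * (2 * (1 + w))"
      using seg[OF that] by (intro mult_left_mono[of 1 _ "\<bar>v\<bar> ^ 3", simplified]) auto
    finally show ?thesis using seg[OF that] by (simp add: abs_mult power_abs field_simps)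
  qed
  from field_differentiable_bound[OF convex_closed_segment dp this, of 0 v v 0]
  have "norm (p v - p 0) \<le> 2 * \<bar>v\<bar> ^ 3 * norm (v - 0)"
    using seg by force
  also have "\<dots> = 2 * v ^ 4"
    by (simp add: power_abs[symmetric] flip: abs_mult) (simp add: abs_mult power_abs eval_nat_numeral)
  finally show ?thesis by (simp add: p_def)
qed

text \<open>Applying \<open>1 + x \<le> exp x\<close> to \<open>x = 2 * v + v\<^sup>2\<close> bounds
  the square of \<open>1 + v\<close>, which also covers \<open>v < - 1\<close>, where
  \<open>ln (1 + v)\<close> gives no information.\<close>

lemma abs_power_exp_le_gauss:
  fixes u v :: real
  assumes n: "n \<ge> 1" and v: "v = u / sqrt (real n)"
  shows "\<bar>(1 + v) ^ n * exp (- real n * v + u\<^sup>2 / 2)\<bar> \<le> exp (u\<^sup>2)"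
proof -
  have u2: "u\<^sup>2 = real n * v\<^sup>2" using n v by (simp add: power_divide)
  have "(1 + v)\<^sup>2 \<le> exp (2 * v + v\<^sup>2)"
    using exp_ge_add_one_self[of "2 * v + v\<^sup>2"] by (simp add: power2_eq_square algebra_simps)
  also have "\<dots> = (exp (v + v\<^sup>2 / 2))\<^sup>2"
    by (simp flip: exp_double)
  finally have "\<bar>1 + v\<bar> \<le> exp (v + v\<^sup>2 / 2)"
    by (subst (asm) power2_le_iff_abs_le) auto
  then have "\<bar>1 + v\<bar> ^ n \<le> exp (v + v\<^sup>2 / 2) ^ n"
    by (rule power_mono) simp
  also have "\<dots> = exp (real n * v + u\<^sup>2 / 2)"
    by (simp add: u2 algebra_simps flip: exp_of_nat_mult)
  finally have "\<bar>1 + v\<bar> ^ n * exp (- real n * v + u\<^sup>2 / 2)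
      \<le> exp (real n * v + u\<^sup>2 / 2) * exp (- real n * v + u\<^sup>2 / 2)"
    by (rule mult_right_mono) simp
  then show ?thesis
    by (simp add: abs_mult power_abs flip: exp_add)
qed


section \<open>Pointwise expansion of the rescaled integrand and its integrable error bound\<close>

text \<open>Reflection and scaling \<open>x = - a * u\<close> reduce this to the Gamma integral on
  the positive half line.\<close>

lemma integrable_power_exp_left_half:
  fixes a :: real
  assumes "a > 0"
  shows "integrable lborel (\<lambda>u. indicator {..0} u * (u ^ k * exp (a * u)))"
proof -
  have "integrable lborel (\<lambda>x::real. indicator {0..} x * (x ^ k * exp (- x)))"
  proof (rule integrableI_nonneg)
    have "(\<integral>\<^sup>+ x. ennreal (indicator {0..} x * (x ^ k * exp (- x))) \<partial>lborel)
        = (\<integral>\<^sup>+ x. ennreal (x ^ k * exp (- x)) * indicator {0..} x \<partial>lborel)"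
      by (intro nn_integral_cong) (auto split: split_indicator)
    then show "(\<integral>\<^sup>+ x. ennreal (indicator {0..} x * (x ^ k * exp (- x))) \<partial>lborel) < \<infinity>"
      by (simp add: nn_intergal_power_times_exp_Ici ennreal_less_top)
  qed (auto split: split_indicator)
  from lborel_integrable_real_affine[OF this, of "- a" 0] assms
  have "integrable lborel (\<lambda>u. (- a) ^ k * (indicator {..0} u * (u ^ k * exp (a * u))))"
    by (simp add: indicator_def mult_le_0_iff mult_ac power_mult_distrib power_minus[of "_ * _"] power_minus[of a])
  then show ?thesis
    using assms by (subst (asm) integrable_mult_left_iff) auto
qed

definition scaled_power :: "nat \<Rightarrow> real \<Rightarrow> real" where
  "scaled_power n u = (1 + u / sqrt n) ^ n * exp (- sqrt n * u + u\<^sup>2 / 2)"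

text \<open>The first summand dominates the error where \<open>u / sqrt n \<ge> - 1/2\<close>. Near
  \<open>u = - 2 * sqrt n\<close>, i.e. at the second maximum of the integrand on the negative half line, there
  is no uniform Gaussian decay, only that of \<open>exp (sqrt 2 * u)\<close>; this is the second summand.\<close>
definition error_weight :: "real \<Rightarrow> real" where
  "error_weight u = (u ^ 4 + u ^ 6 + u ^ 8) * exp (- u\<^sup>2 / 2 + sqrt 2 * u)
     + indicator {..0} u * (u ^ 4 * exp (sqrt 2 * u))"

text \<open>The weight is, up to a constant, the normal density with mean \<open>1 / sqrt 2\<close>
  and variance 1/2. For \<open>v \<ge> - 1 / 2\<close> the power is written as an exponential and
  expanded; for smaller \<open>v\<close> both terms are bounded separately, since there 1 is already
  dominated by a multiple of \<open>u ^ 4 / n\<close>.\<close>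

lemma scaled_power_expansion:
  assumes n: "n \<ge> 1"
  shows "\<bar>scaled_power n u - (1 + u ^ 3 / (3 * sqrt n))\<bar> * exp (- u\<^sup>2 + sqrt 2 * u)
    \<le> 17 / n * error_weight u"
proof -
  define v where "v = u / sqrt (real n)"
  define N where "N = real n"
  have N: "N \<ge> 1" using n by (simp add: N_def)
  have u: "u = sqrt N * v" using N by (simp add: v_def N_def)
  have sN: "sqrt N * (sqrt N * x) = N * x" for x
    using N by (simp add: mult.assoc[symmetric])
  have pow: "u\<^sup>2 = N * v\<^sup>2" "u ^ 4 = N\<^sup>2 * v ^ 4" "u ^ 6 = N ^ 3 * v ^ 6" "u ^ 8 = N ^ 4 * v ^ 8"
    "u ^ 3 / sqrt N = N * v ^ 3"
    unfolding u using N by (simp_all add: eval_nat_numeral sN mult_ac)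
  have phi: "scaled_power n u = (1 + v) ^ n * exp (- N * v + u\<^sup>2 / 2)"
    using N by (simp add: scaled_power_def v_def N_def real_div_sqrt mult_ac)
      (simp add: real_div_sqrt flip: times_divide_eq_right)
  define E where "E = exp (- u\<^sup>2 / 2 + sqrt 2 * u)"
  have E: "E > 0" by (simp add: E_def)
  have G: "exp (- u\<^sup>2 + sqrt 2 * u) = exp (- (u\<^sup>2 / 2)) * E"
    by (simp add: E_def flip: exp_add)
  have cubic: "u ^ 3 / (3 * sqrt (real n)) = N * v ^ 3 / 3"
    using pow(5) by (simp add: N_def)
  have W1: "(u ^ 4 + u ^ 6 + u ^ 8) * E \<le> error_weight u"
    by (simp add: error_weight_def E_def indicator_def)
  show ?thesis
  proof (cases "v \<ge> - 1 / 2")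
    case True
    define h where "h = ln (1 + v) - v + v\<^sup>2 / 2"
    define x where "x = N * h"
    have "scaled_power n u = exp x"
    proof -
      have "(1 + v) ^ n = exp (N * ln (1 + v))"
        using True by (simp add: N_def exp_of_nat_mult)
      then show ?thesis
        by (simp add: phi x_def h_def pow algebra_simps flip: exp_add)
    qed
    have "h \<le> v\<^sup>2 / 2"
      using ln_le_minus_one[of "1 + v"] True by (simp add: h_def)
    \<comment> \<open>The factor \<open>exp (u\<^sup>2 / 2)\<close> that this costs uses up half of
      the decay \<open>exp (- u\<^sup>2)\<close>; the other half remains in
      \<open>E\<close>.\<close>
    then have xle: "x \<le> u\<^sup>2 / 2"
      using N by (simp add: x_def pow mult_left_mono)
    have hb: "\<bar>h - v ^ 3 / 3\<bar> \<le> 2 * v ^ 4"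
      using ln_cubic_taylor_bound[OF True] by (simp add: h_def)
    have xb: "\<bar>x - N * v ^ 3 / 3\<bar> \<le> 2 * N * v ^ 4"
    proof -
      have "\<bar>x - N * v ^ 3 / 3\<bar> = N * \<bar>h - v ^ 3 / 3\<bar>"
        using N abs_mult[of N "h - v ^ 3 / 3"] by (simp add: x_def right_diff_distrib)
      also have "\<dots> \<le> N * (2 * v ^ 4)" using hb N by (intro mult_left_mono) auto
      finally show ?thesis by simp
    qed
    have h2: "h\<^sup>2 \<le> 2 * (v ^ 6 / 9 + 4 * v ^ 8)"
    proof -
      have "(h - v ^ 3 / 3)\<^sup>2 \<le> (2 * v ^ 4)\<^sup>2"
        using hb by (intro power2_le_iff_abs_le[THEN iffD2]) auto
      \<comment> \<open>This is \<open>(a + b)\<^sup>2 \<le> 2 * (a\<^sup>2 + b\<^sup>2)\<close>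
        with \<open>a = v ^ 3 / 3\<close> and \<open>b = h - a\<close>.\<close>
      moreover have "h\<^sup>2 \<le> 2 * ((v ^ 3 / 3)\<^sup>2 + (h - v ^ 3 / 3)\<^sup>2)"
        using zero_le_power2[of "h - 2 * (v ^ 3 / 3)"]
        by (simp add: power2_eq_square algebra_simps)
      ultimately show ?thesis
        by (simp add: power_mult_distrib power_divide flip: power_mult)
    qed
    have "x\<^sup>2 / 2 \<le> N\<^sup>2 * (v ^ 6 / 9 + 4 * v ^ 8)"
      using mult_left_mono[OF h2, of "N\<^sup>2"] by (simp add: x_def power_mult_distrib algebra_simps)
    have "\<bar>exp x - 1 - x\<bar> \<le> x\<^sup>2 / 2 * exp (u\<^sup>2 / 2)"
      by (rule exp_minus_one_minus_id_bound[OF xle]) simp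
    also have "\<dots> \<le> N\<^sup>2 * (v ^ 6 / 9 + 4 * v ^ 8) * exp (u\<^sup>2 / 2)"
      by (intro mult_right_mono) (fact, simp)
    finally have "\<bar>exp x - 1 - x\<bar> \<le> N\<^sup>2 * (v ^ 6 / 9 + 4 * v ^ 8) * exp (u\<^sup>2 / 2)" .
    moreover have "2 * N * v ^ 4 * 1 \<le> 2 * N * v ^ 4 * exp (u\<^sup>2 / 2)"
      using N by (intro mult_left_mono) auto
    ultimately have 1: "\<bar>exp x - (1 + N * v ^ 3 / 3)\<bar>
        \<le> (2 * N * v ^ 4 + N\<^sup>2 * (v ^ 6 / 9 + 4 * v ^ 8)) * exp (u\<^sup>2 / 2)"
      using xb unfolding distrib_right by linarith
    \<comment> \<open>Here \<open>N * v ^ 4 = u ^ 4 / N\<close>,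
      \<open>N\<^sup>2 * v ^ 6 = u ^ 6 / N\<close> and
      \<open>N\<^sup>2 * v ^ 8 = u ^ 8 / N\<^sup>2 \<le> u ^ 8 / N\<close>. The constant 4 would do;
      17 comes from the case \<open>v < - 1 / 2\<close>.\<close>
    have "2 * N * v ^ 4 + N\<^sup>2 * (v ^ 6 / 9 + 4 * v ^ 8) \<le> 17 / N * (u ^ 4 + u ^ 6 + u ^ 8)"
    proof -
      define p q r where "p = N * v ^ 4" "q = N\<^sup>2 * v ^ 6" "r = N\<^sup>2 * v ^ 8"
      have "r * 1 \<le> r * N" using N by (intro mult_left_mono) (auto simp: p_q_r_def)
      moreover have "p \<ge> 0" "q \<ge> 0" "r \<ge> 0" using N by (simp_all add: p_q_r_def)
      ultimately have "2 * p + q / 9 + 4 * r \<le> 17 * (p + q + r * N)"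
        unfolding distrib_left by linarith
      moreover have "17 / N * (u ^ 4 + u ^ 6 + u ^ 8) = 17 * (p + q + r * N)"
        unfolding pow p_q_r_def using N by (simp add: field_simps eval_nat_numeral)
      moreover have "2 * N * v ^ 4 + N\<^sup>2 * (v ^ 6 / 9 + 4 * v ^ 8) = 2 * p + q / 9 + 4 * r"
        by (simp add: p_q_r_def algebra_simps)
      ultimately show ?thesis by (simp only:)
    qed
    from order_trans[OF 1 mult_right_mono[OF this]]
    have "\<bar>exp x - (1 + N * v ^ 3 / 3)\<bar>
        \<le> 17 / N * (u ^ 4 + u ^ 6 + u ^ 8) * exp (u\<^sup>2 / 2)" by simp
    from mult_right_mono[OF this, of "exp (- (u\<^sup>2 / 2))"]
    have "\<bar>exp x - (1 + N * v ^ 3 / 3)\<bar> * exp (- (u\<^sup>2 / 2)) \<le> 17 / N * (u ^ 4 + u ^ 6 + u ^ 8)"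
      by (simp add: mult.assoc flip: exp_add)
    from mult_right_mono[OF this, of E]
    have "\<bar>exp x - (1 + N * v ^ 3 / 3)\<bar> * exp (- u\<^sup>2 + sqrt 2 * u)
        \<le> 17 / N * ((u ^ 4 + u ^ 6 + u ^ 8) * E)"
      using E by (simp only: G mult.assoc less_imp_le)
    also have "\<dots> \<le> 17 / N * error_weight u" using W1 N by (intro mult_left_mono) auto
    finally show ?thesis
      unfolding \<open>scaled_power n u = exp x\<close> cubic N_def .
  next
    case False
    then have v: "v < - 1 / 2" by simp
    then have "u \<le> 0" using N by (simp add: u mult_le_0_iff)
    have av: "1 \<le> 2 * \<bar>v\<bar>" using v by simp
    have v4: "1 \<le> 16 * v ^ 4"
      using one_le_power[OF av, of 4] by (simp add: power_mult_distrib)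
    have "N * v ^ 4 = u ^ 4 / N" using N by (simp add: pow power2_eq_square)
    have "1 * 1 \<le> N * (16 * v ^ 4)" using N v4 by (intro mult_mono) auto
    then have one: "1 \<le> 16 * u ^ 4 / N"
      using \<open>N * v ^ 4 = u ^ 4 / N\<close> by simp
    have "N * \<bar>v\<bar> ^ 3 * 1 \<le> N * \<bar>v\<bar> ^ 3 * (2 * \<bar>v\<bar>)"
      using N av by (intro mult_left_mono) auto
    also have "\<dots> = 2 * (N * \<bar>v\<bar> ^ 4)" by (simp add: eval_nat_numeral)
    finally have "\<bar>N * v ^ 3\<bar> \<le> 2 * u ^ 4 / N"
      using \<open>N * v ^ 4 = u ^ 4 / N\<close> N by (simp add: abs_mult power_abs)
    \<comment> \<open>The summand 1 contributes 16 and the cubic term 2/3, together at most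
      17.\<close>
    with one have poly: "\<bar>1 + N * v ^ 3 / 3\<bar> \<le> 17 * u ^ 4 / N" by (simp add: field_simps)
    let ?G = "exp (- u\<^sup>2 + sqrt 2 * u)"
    \<comment> \<open>The Gaussian decay cancels completely, leaving
      \<open>exp (sqrt 2 * u)\<close>, which is integrable on \<open>u \<le> 0\<close>. This is
      absorbed by the indicator summand of \<open>error_weight\<close>, the polynomial part by the
      first summand.\<close>
    have "\<bar>scaled_power n u\<bar> * ?G \<le> exp (u\<^sup>2) * ?G"
      using abs_power_exp_le_gauss[OF n v_def] unfolding phi N_def by (intro mult_right_mono) auto
    also have "\<dots> = 1 * exp (sqrt 2 * u)" by (simp flip: exp_add)
    also have "\<dots> \<le> 16 * u ^ 4 / N * exp (sqrt 2 * u)" using one by (intro mult_right_mono) auto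
    finally have 1: "\<bar>scaled_power n u\<bar> * ?G \<le> 17 / N * (u ^ 4 * exp (sqrt 2 * u))"
      using N by (elim order_trans) (simp add: divide_right_mono)
    have "\<bar>1 + N * v ^ 3 / 3\<bar> * ?G \<le> 17 * u ^ 4 / N * E"
      using poly N by (intro mult_mono) (auto simp: E_def)
    also have "\<dots> \<le> 17 / N * ((u ^ 4 + u ^ 6 + u ^ 8) * E)"
      using N E by (simp add: field_simps)
    finally have "\<bar>1 + N * v ^ 3 / 3\<bar> * ?G \<le> 17 / N * ((u ^ 4 + u ^ 6 + u ^ 8) * E)" .
    with 1 have "(\<bar>scaled_power n u\<bar> + \<bar>1 + N * v ^ 3 / 3\<bar>) * ?G \<le> 17 / N * error_weight u"
      using \<open>u \<le> 0\<close> by (simp add: error_weight_def E_def distrib_left distrib_right)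
    moreover have "\<bar>scaled_power n u - (1 + N * v ^ 3 / 3)\<bar> * ?G
        \<le> (\<bar>scaled_power n u\<bar> + \<bar>1 + N * v ^ 3 / 3\<bar>) * ?G"
      by (intro mult_right_mono abs_triangle_ineq4) auto
    ultimately show ?thesis
      unfolding cubic N_def by (rule order_trans[rotated])
  qed
qed

lemma integrable_error_weight: "integrable lborel error_weight"
proof -
  let ?d = "normal_density (sqrt 2) 1"
  \<comment> \<open>Completing the square:
    \<open>- u\<^sup>2 / 2 + sqrt 2 * u = 1 - (u - sqrt 2)\<^sup>2 / 2\<close>.\<close>
  have d: "exp (- u\<^sup>2 / 2 + sqrt 2 * u) = exp 1 * sqrt (2 * pi) * ?d u" for u
    by (simp add: normal_density_def power2_diff flip: exp_add) (simp add: field_simps)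
  have "integrable lborel (\<lambda>u. (exp 1 * sqrt (2 * pi)) * (u ^ 4 * ?d u + u ^ 6 * ?d u + u ^ 8 * ?d u))"
    by (intro integrable_mult_right Bochner_Integration.integrable_add
        integrable_normal_raw_moment) simp_all
  then have "integrable lborel (\<lambda>u. (u ^ 4 + u ^ 6 + u ^ 8) * exp (- u\<^sup>2 / 2 + sqrt 2 * u))"
    unfolding d by (simp add: algebra_simps)
  then show ?thesis
    unfolding error_weight_def
    by (intro Bochner_Integration.integrable_add integrable_power_exp_left_half) simp_all
qed


section \<open>The limiting third moment and the change of variables\<close>

lemma gauss_half_third_moment:
  "(\<integral>u. u ^ 3 * normal_density (1 / sqrt 2) (1 / sqrt 2) u \<partial>lborel) = sqrt 2"
proof -
  let ?M = "\<lambda>k. \<integral>u. u ^ k * normal_density (1 / sqrt 2) (1 / sqrt 2) u \<partial>lborel"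
  have "?M 1 = 1 / sqrt 2"
    using integral_normal_moment_nz_1[of "1 / sqrt 2" "1 / sqrt 2"] by (simp add: mult.commute)
  moreover from this have "?M 2 = 1"
    using normal_raw_moment_rec[where \<mu> = "1 / sqrt 2" and \<sigma> = "1 / sqrt 2" and k = 0]
    by (simp add: power_divide eval_nat_numeral)
  moreover have "?M 3 = 1 / sqrt 2 * ?M 2 + ?M 1"
    using normal_raw_moment_rec[where \<mu> = "1 / sqrt 2" and \<sigma> = "1 / sqrt 2" and k = 1]
    by (simp add: power_divide eval_nat_numeral)
  ultimately have "?M 3 = 2 / sqrt 2" by simp
  then show ?thesis by (simp add: real_div_sqrt)
qed

text \<open>Near its peak \<open>x ^ n\<close> contributes
  \<open>exp (sqrt n * u - u\<^sup>2 / 2)\<close> to leading order. Moving this out of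
  \<open>scaled_power\<close> turns the variance 1 of the substituted density into 1/2 and cancels
  the linear term in \<open>sqrt n * u\<close>.\<close>

lemma normal_2_raw_moment_rescaled:
  fixes n :: nat
  assumes n: "n \<ge> 1"
  defines "C \<equiv> exp (sqrt (2 * real n)) / sqrt (2 * exp 1) * (2 * real n / exp 1) powr (real n / 2)"
  shows "(\<integral>x. x ^ n * normal_density 2 (sqrt 2) x \<partial>lborel)
      = C * (\<integral>u. scaled_power n u * normal_density (1 / sqrt 2) (1 / sqrt 2) u \<partial>lborel)"
    and "integrable lborel (\<lambda>u. scaled_power n u * normal_density (1 / sqrt 2) (1 / sqrt 2) u)"
proof -
  let ?d = "normal_density (1 / sqrt 2) (1 / sqrt 2)"
  let ?f = "\<lambda>x. x ^ n * normal_density 2 (sqrt 2) x"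
  define s where "s = sqrt (real n)"
  have s: "s > 0" "s\<^sup>2 = real n" "sqrt (2 * real n) = sqrt 2 * s"
    using n by (simp_all add: s_def real_sqrt_mult)
  have C: "C > 0" using n by (simp add: C_def)
  have pw: "(2 * real n / exp 1) powr (real n / 2) = (sqrt 2 * s) ^ n * exp (- real n / 2)"
  proof -
    have "(2 * real n) powr (real n / 2) = (sqrt 2 * s) ^ n"
      using n powr_powr[of "2 * real n" "1 / 2" "real n"]
      by (simp add: powr_half_sqrt powr_realpow s_def real_sqrt_mult)
    moreover have "exp 1 powr (real n / 2) = exp (real n / 2)"
      by (simp add: powr_def)
    moreover have "exp (- real n / 2) = 1 / exp (real n / 2)"
      by (simp add: exp_minus inverse_eq_divide)
    ultimately show ?thesis
      by (simp add: powr_divide)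
  qed
  \<comment> \<open>The divisor \<open>sqrt 2\<close> is cancelled by the Jacobian of the
    substitution.\<close>
  have eq: "?f (sqrt 2 * s + sqrt 2 * u) = C / sqrt 2 * (scaled_power n u * ?d u)" for u
  proof -
    have "sqrt 2 * s + sqrt 2 * u = (sqrt 2 * s) * (1 + u / s)"
      using s by (simp add: field_simps)
    then have 1: "(sqrt 2 * s + sqrt 2 * u) ^ n = (sqrt 2 * s) ^ n * (1 + u / s) ^ n"
      by (simp add: power_mult_distrib)
    have 2: "normal_density 2 (sqrt 2) (sqrt 2 * s + sqrt 2 * u)
        = 1 / (2 * sqrt pi) * exp (- (s + u - sqrt 2)\<^sup>2 / 2)"
    proof -
      have "sqrt 2 * s + sqrt 2 * u - 2 = sqrt 2 * (s + u - sqrt 2)"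
        by (simp add: algebra_simps)
      then show ?thesis by (simp add: normal_density_def power_mult_distrib real_sqrt_mult)
    qed
    have 3: "?d u = 1 / sqrt pi * exp (- (u - 1 / sqrt 2)\<^sup>2)"
      by (simp add: normal_density_def power_divide)
    have "sqrt (exp 1) = exp (1 / 2)"
      by (rule real_sqrt_unique) (simp_all flip: exp_double)
    then have 4: "sqrt (2 * exp 1) = sqrt 2 * exp (1 / 2)"
      by (simp add: real_sqrt_mult)
    \<comment> \<open>Expanding the square gives the constant -1: one half belongs to
      \<open>1 / sqrt (exp 1)\<close> in \<open>C\<close>, the other completes the square in
      \<open>u - 1 / sqrt 2\<close>.\<close>
    have "exp (- (s + u - sqrt 2)\<^sup>2 / 2)
        = exp (sqrt 2 * s) * exp (- real n / 2) * exp (- (1 / 2))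
          * exp (- s * u + u\<^sup>2 / 2) * exp (- (u - 1 / sqrt 2)\<^sup>2)"
      unfolding exp_add[symmetric]
      by (rule arg_cong[where f = exp]) (simp add: power2_eq_square field_simps flip: s(2))
    then show ?thesis
      unfolding 1 2 3 C_def pw 4 s(3) scaled_power_def s_def[symmetric]
      by (simp add: exp_minus field_simps)
  qed
  have "integrable lborel (\<lambda>u. ?f (sqrt 2 * s + sqrt 2 * u))"
    by (intro lborel_integrable_real_affine integrable_normal_raw_moment) simp_all
  then have "integrable lborel (\<lambda>u. C / sqrt 2 * (scaled_power n u * ?d u))"
    unfolding eq .
  then show "integrable lborel (\<lambda>u. scaled_power n u * ?d u)"
    using C by (subst (asm) integrable_mult_left_iff) auto
  show "integral\<^sup>L lborel ?f = C * (\<integral>u. scaled_power n u * ?d u \<partial>lborel)"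
    using lborel_integral_real_affine[of "sqrt 2" ?f "sqrt 2 * s"] unfolding eq by simp
qed

section \<open>Assembling the asymptotic expansion\<close>

theorem mainTheorem1:
  fixes I :: "nat \<Rightarrow> real"
  assumes "I 0 = 1"
    and "I 1 = 2"
    and "\<And>n. n \<ge> 2 \<Longrightarrow> I n = 2 * (I (n - 1) + (real n - 1) * I (n - 2))"
  shows "\<exists>\<epsilon> :: nat \<Rightarrow> real. \<epsilon> \<in> O(\<lambda>n. 1 / real n) \<and>
    (\<forall>n\<ge>1. I n = exp (sqrt (2 * real n)) / sqrt (2 * exp 1)
        * (2 * real n / exp 1) powr (real n / 2)
        * (1 + sqrt 2 / (3 * sqrt (real n)) + \<epsilon> n))"
proof -
  let ?d = "normal_density (1 / sqrt 2) (1 / sqrt 2)"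
  \<comment> \<open>With mean 2 and variance 2 the moment recurrence is exactly that of
    \<open>I\<close>.\<close>
  have moment: "I n = (\<integral>x. x ^ n * normal_density 2 (sqrt 2) x \<partial>lborel)" for n
  proof (induction n rule: induct_nat_012)
    case 0
    then show ?case using assms(1) by simp
  next
    case 1
    then show ?case
      using assms(2) integral_normal_moment_nz_1[of "sqrt 2" 2] by (simp add: mult.commute)
  next
    case (ge2 n)
    then show ?case
      using assms(3)[of "Suc (Suc n)"] normal_raw_moment_rec[where \<mu> = 2 and \<sigma> = "sqrt 2" and k = n] by simp
  qed
  \<comment> \<open>As the exact defect, \<open>\<epsilon>\<close> satisfies the required identity
    by definition; only its order of magnitude remains to be bounded.\<close>
  define \<epsilon> where "\<epsilon> n = (\<integral>u. scaled_power n u * ?d u \<partial>lborel) - (1 + sqrt 2 / (3 * sqrt (real n)))"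
    for n
  \<comment> \<open>17 is the constant of the pointwise bound, and
    \<open>exp (- 1 / 2) / sqrt pi\<close> normalises \<open>exp (- u\<^sup>2 + sqrt 2 * u)\<close>
    to the density \<open>?d\<close>.\<close>
  define K where "K = 17 * (exp (- 1 / 2) / sqrt pi) * integral\<^sup>L lborel error_weight"
  have d: "?d u = exp (- u\<^sup>2 + sqrt 2 * u) * (exp (- 1 / 2) / sqrt pi)" for u
    by (simp add: normal_density_def power2_diff power_divide field_simps flip: exp_add)
  have "\<bar>\<epsilon> n\<bar> \<le> K * \<bar>1 / real n\<bar>" if n: "n \<ge> 1" for n
  proof -
    let ?p = "\<lambda>u. 1 + u ^ 3 / (3 * sqrt (real n))"
    note int0 = normal_2_raw_moment_rescaled(2)[OF n]
    have p: "?p u * ?d u = ?d u + 1 / (3 * sqrt (real n)) * (u ^ 3 * ?d u)" for u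
      by (simp add: algebra_simps)
    have int1: "integrable lborel (\<lambda>u. ?p u * ?d u)"
      unfolding p by (intro Bochner_Integration.integrable_add integrable_mult_right
          integrable_normal_raw_moment integrable_normal_density) simp_all
    have "(\<integral>u. ?p u * ?d u \<partial>lborel) = 1 + sqrt 2 / (3 * sqrt (real n))"
      unfolding p by (subst Bochner_Integration.integral_add)
        (simp_all add: integrable_normal_raw_moment gauss_half_third_moment)
    then have "\<epsilon> n = (\<integral>u. scaled_power n u * ?d u - ?p u * ?d u \<partial>lborel)"
      unfolding \<epsilon>_def by (subst Bochner_Integration.integral_diff[OF int0 int1]) simp
    then have "\<bar>\<epsilon> n\<bar> \<le> (\<integral>u. \<bar>scaled_power n u * ?d u - ?p u * ?d u\<bar> \<partial>lborel)"
      by (simp only: integral_abs_bound)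
    also have "\<dots> \<le> (\<integral>u. 17 / n * (exp (- 1 / 2) / sqrt pi) * error_weight u \<partial>lborel)"
    proof (rule integral_mono)
      fix u
      have "\<bar>scaled_power n u * ?d u - ?p u * ?d u\<bar> = \<bar>scaled_power n u - ?p u\<bar> * ?d u"
        by (simp add: abs_mult flip: left_diff_distrib)
      also have "\<dots> = \<bar>scaled_power n u - ?p u\<bar> * exp (- u\<^sup>2 + sqrt 2 * u) * (exp (- 1 / 2) / sqrt pi)"
        by (simp only: d mult.assoc)
      also have "\<dots> \<le> 17 / n * error_weight u * (exp (- 1 / 2) / sqrt pi)"
        by (intro mult_right_mono scaled_power_expansion[OF n]) simp
      finally show "\<bar>scaled_power n u * ?d u - ?p u * ?d u\<bar>
          \<le> 17 / n * (exp (- 1 / 2) / sqrt pi) * error_weight u"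
        by (simp only: mult_ac)
    qed (intro integrable_abs Bochner_Integration.integrable_diff int0 int1 integrable_mult_right
        integrable_error_weight)+
    also have "\<dots> = K * \<bar>1 / real n\<bar>"
      by (simp add: K_def)
    finally show ?thesis .
  qed
  then have "\<epsilon> \<in> O(\<lambda>n. 1 / real n)"
    by (intro bigoI[of _ K] eventually_at_top_linorderI[of 1]) simp
  moreover have "I n = exp (sqrt (2 * real n)) / sqrt (2 * exp 1)
        * (2 * real n / exp 1) powr (real n / 2)
        * (1 + sqrt 2 / (3 * sqrt (real n)) + \<epsilon> n)" if "n \<ge> 1" for n
    unfolding moment normal_2_raw_moment_rescaled(1)[OF that] \<epsilon>_def by simp
  ultimately show ?thesis by blast
qed

end
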